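(* Let $f$ be a function on $\mathbb R$ whose Fourier transform vanishes for negative arguments, normalised ($\int_0^\infty\frac{dp}{2p}|\tilde f(p)|^2=1$), such that $f$ and its derivative $f'$ exist and are integrable, and suppose there are constants $C>0$, $L\ge1$, $\alpha>1/2$ with $|f(y)|\le C/y^{1+\alpha}$ for $y\ge L$. Let $f_{y_o}(y)=f(y-y_o)$. Then for every $y_o\le -4(1+L)$, \[ \bar N[f_{y_o}]\le \frac{1}{\alpha(2\alpha-1)}\,\frac{8C^2}{(-y_o/4+L/2-1)^{2\alpha-1}}+20\,e^{4L+y_o/2}\big(2^{1+\alpha}C+\|f\|_{L^1}+\|f'\|_{L^1}\big)^2.\]
   Context: Fourier transforms: $\tilde g(p)=(2\pi)^{-1/2}\int g(y)e^{-ipy}dy$. With $x(y)=-\log(1+e^{-y})$, $\widetilde{\check f}(-k)=(2\pi)^{-1/2}\int_{\mathbb R} f(y)e^{ikx(y)}dy$ for $k\ge0$, and the mean number of created particles is $\bar N[f]=\int_0^\infty\frac{dk}{2k}|\widetilde{\check f}(-k)|^2$. *)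

theory Defs
  imports "HOL-Analysis.Analysis"
begin

definition fourier :: "(real \<Rightarrow> complex) \<Rightarrow> real \<Rightarrow> complex" where
  "fourier g p = complex_of_real (1 / sqrt (2 * pi)) *
     (LINT y|lborel. g y * exp (- \<i> * complex_of_real (p * y)))"

definition xmap :: "real \<Rightarrow> real" where
  "xmap y = - ln (1 + exp (- y))"

text \<open>The quantity tilde-check f (-k) = (2 pi)^(-1/2) int f(y) e^(i k x(y)) dy.\<close>
definition fcheck_tilde :: "(real \<Rightarrow> complex) \<Rightarrow> real \<Rightarrow> complex" where
  "fcheck_tilde g k = complex_of_real (1 / sqrt (2 * pi)) *
     (LINT y|lborel. g y * exp (\<i> * complex_of_real (k * xmap y)))"

text \<open>Mean number of created particles (as an extended nonnegative real, may be infinite).\<close>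
definition Nbar :: "(real \<Rightarrow> complex) \<Rightarrow> ennreal" where
  "Nbar g = (\<integral>\<^sup>+ k. indicator {0<..} k * ennreal ((cmod (fcheck_tilde g k))\<^sup>2 / (2 * k)) \<partial>lborel)"

end

theory Submission
  imports Defs
begin

text \<open>
  Split the amplitude \<open>\<integral> f(u) exp (i k x(u + y\<^sub>o)) du\<close> at a point \<open>B\<close> depending on \<open>k\<close>. To the right
  of \<open>B\<close> the decay of \<open>f\<close> gives a contribution of order \<open>(C/\<alpha>) B powr (-\<alpha>)\<close>. To the left, either compare
  with the plane wave \<open>exp (i k (u + y\<^sub>o))\<close>, whose integral against \<open>f\<close> vanishes by positivity of the
  frequencies and which differs from the true phase by at most \<open>k exp (B + y\<^sub>o)\<close>, or integrate by parts,
  which gains \<open>1/k\<close> at the price of the factor \<open>1/x' = 1 + exp (u + y\<^sub>o)\<close>.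

  With \<open>s = -y\<^sub>o/2\<close> and \<open>K = exp (s/2)\<close> take \<open>B = s - (ln k)/2\<close> for \<open>k < 1\<close> and \<open>B = s\<close> for
  \<open>1 \<le> k \<le> K\<close> in the comparison, and \<open>B = s + ln(k/K)/2\<close> for \<open>k \<ge> K\<close> in the integration by parts.
  Integrated against \<open>dk/k\<close>, the squared tails give \<open>s powr (1 - 2 \<alpha>)\<close> and the rest gives \<open>exp (-s) = exp (y\<^sub>o/2)\<close>.
\<close>

section \<open>Fundamental theorem of calculus for nonnegative integrands on open intervals\<close>

lemma nn_integral_FTC_einterval:
  fixes F g :: "real \<Rightarrow> real" and a b :: ereal
  assumes "a < b"
    and F: "\<And>x. a < ereal x \<Longrightarrow> ereal x < b \<Longrightarrow> DERIV F x :> g x"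
    and g: "\<And>x. a < ereal x \<Longrightarrow> ereal x < b \<Longrightarrow> isCont g x"
    and nonneg: "\<And>x. a < ereal x \<Longrightarrow> ereal x < b \<Longrightarrow> 0 \<le> g x"
    and A: "((F \<circ> real_of_ereal) \<longlongrightarrow> A) (at_right a)"
    and B: "((F \<circ> real_of_ereal) \<longlongrightarrow> B) (at_left b)"
  shows "(\<integral>\<^sup>+x. ennreal (indicator (einterval a b) x * g x) \<partial>lborel) = ennreal (B - A)"
proof -
  note FTC = interval_integral_FTC_nonneg[OF \<open>a < b\<close> F g _ A B]
  have "(\<integral>\<^sup>+x. ennreal (indicator (einterval a b) x * g x) \<partial>lborel)
      = ennreal (LINT x|lborel. indicator (einterval a b) x * g x)"
    using FTC(1) nonneg
    by (intro nn_integral_eq_integral)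
       (auto simp: set_integrable_def einterval_def split: split_indicator)
  also have "(LINT x|lborel. indicator (einterval a b) x * g x) = B - A"
    using FTC(2) nonneg less_imp_le[OF \<open>a < b\<close>]
    by (simp add: interval_lebesgue_integral_def set_lebesgue_integral_def)
  finally show ?thesis .
qed

section \<open>Oscillating phases and the coordinate \<open>xmap\<close>\<close>

lemma norm_exp_i_diff_le:
  "cmod (exp (\<i> * complex_of_real s) - exp (\<i> * complex_of_real t)) \<le> \<bar>s - t\<bar>"
proof -
  have "exp (\<i> * complex_of_real s) - exp (\<i> * complex_of_real t)
      = exp (\<i> * complex_of_real t) * (exp (\<i> * complex_of_real (s - t)) - 1)"
    by (simp add: algebra_simps flip: exp_add)
  then have "cmod (exp (\<i> * complex_of_real s) - exp (\<i> * complex_of_real t))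
      = 2 * \<bar>sin ((s - t) / 2)\<bar>"
    by (metis dist_exp_i_1 mult_1 norm_exp_i_times norm_mult)
  also have "\<dots> \<le> \<bar>s - t\<bar>"
    using abs_sin_x_le_abs_x[of "(s - t) / 2"] by simp
  finally show ?thesis .
qed

lemma norm_exp_i_diff_le_2:
  "cmod (exp (\<i> * complex_of_real s) - exp (\<i> * complex_of_real t)) \<le> 2"
  by (rule order_trans[OF norm_triangle_ineq4]) simp

lemma one_plus_exp_neq_0: "1 + exp (y::real) \<noteq> 0"
  using exp_gt_zero[of y] by linarith

lemma DERIV_xmap: "(xmap has_real_derivative 1 / (1 + exp y)) (at y)"
proof -
  have "(xmap has_real_derivative exp (- y) / (1 + exp (- y))) (at y)"
    unfolding xmap_def [abs_def]
    by (auto intro!: derivative_eq_intros simp: add_pos_pos)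
  moreover have "exp (- y) / (1 + exp (- y)) = 1 / (1 + exp y)"
    by (simp add: exp_minus field_simps one_plus_exp_neq_0)
  ultimately show ?thesis by simp
qed

lemma continuous_on_xmap: "continuous_on S xmap"
  by (meson DERIV_xmap DERIV_continuous continuous_at_imp_continuous_on)

lemma measurable_xmap [measurable]: "xmap \<in> borel_measurable borel"
  by (rule borel_measurable_continuous_onI) (rule continuous_on_xmap)

text \<open>The difference \<open>y - xmap y\<close> is exactly \<open>ln (1 + exp y)\<close>, and
  \<open>ln (1 + t) \<le> t\<close>. Far to the left the phase is therefore exponentially close to
  that of a plane wave.\<close>

lemma abs_xmap_diff_le: "\<bar>xmap y - y\<bar> \<le> exp y"
proof -
  have "1 + exp y = exp y * (1 + exp (- y))"
    by (simp add: algebra_simps flip: exp_add)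
  then have "ln (1 + exp y) = y + ln (1 + exp (- y))"
    by (metis add_pos_pos exp_gt_zero ln_exp ln_mult_pos zero_less_one)
  then have "y - xmap y = ln (1 + exp y)"
    by (simp add: xmap_def)
  then show ?thesis
    using ln_add_one_self_le_self[of "exp y"] ln_ge_zero[of "1 + exp y"] exp_gt_zero[of y] by linarith
qed

section \<open>Amplitude estimates: tail, plane-wave comparison, integration by parts\<close>

lemma tail_integral_le:
  fixes f :: "real \<Rightarrow> complex"
  assumes int_f: "integrable lborel f" and "C > 0" "\<alpha> > 0" "B > 0"
    and decay: "\<forall>y\<ge>B. cmod (f y) \<le> C / y powr (1 + \<alpha>)"
  shows "(LINT u|lborel. indicator {B..} u * cmod (f u)) \<le> C / \<alpha> * B powr (- \<alpha>)"
proof -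
  let ?F = "\<lambda>u. - (C / \<alpha>) * u powr (- \<alpha>)"
  have FTC: "(\<integral>\<^sup>+u. ennreal (C / u powr (1 + \<alpha>)) * indicator {B..} u \<partial>lborel) = ennreal (0 - ?F B)"
  proof (rule nn_integral_FTC_atLeast)
    show "DERIV ?F u :> C / u powr (1 + \<alpha>)" if "B \<le> u" for u
    proof -
      have "u powr (- \<alpha> - 1) = 1 / u powr (1 + \<alpha>)"
        by (metis minus_add_distrib powr_minus_divide uminus_add_conv_diff diff_minus_eq_add add.commute)
      then show ?thesis
        using that assms by (auto intro!: derivative_eq_intros simp: field_simps)
    qed
    show "(?F \<longlongrightarrow> 0) at_top"
      using \<open>\<alpha> > 0\<close> by (intro tendsto_mult_right_zero tendsto_neg_powr filterlim_ident) simp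
  qed (use assms in auto)
  have "(LINT u|lborel. indicator {B..} u * cmod (f u))
      = enn2real (\<integral>\<^sup>+u. ennreal (indicator {B..} u * cmod (f u)) \<partial>lborel)"
    using int_f by (intro integral_eq_nn_integral) auto
  also have "\<dots> \<le> enn2real (\<integral>\<^sup>+u. ennreal (C / u powr (1 + \<alpha>)) * indicator {B..} u \<partial>lborel)"
  proof (rule enn2real_mono)
    show "(\<integral>\<^sup>+u. ennreal (indicator {B..} u * cmod (f u)) \<partial>lborel)
        \<le> (\<integral>\<^sup>+u. ennreal (C / u powr (1 + \<alpha>)) * indicator {B..} u \<partial>lborel)"
      using decay by (intro nn_integral_mono) (auto intro!: ennreal_leI split: split_indicator)
    show "(\<integral>\<^sup>+u. ennreal (C / u powr (1 + \<alpha>)) * indicator {B..} u \<partial>lborel) < top"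
      unfolding FTC by simp
  qed
  also have "\<dots> = C / \<alpha> * B powr (- \<alpha>)"
    unfolding FTC using assms by simp
  finally show ?thesis .
qed

text \<open>Common form of the splitting at \<open>B\<close>: \<open>a\<close> is the relative size
  of \<open>g\<close> allowed everywhere, \<open>b\<close> the extra size allowed to the right of
  \<open>B\<close>, where the decay pays for it. The plane-wave comparison takes
  \<open>b = 2\<close>; the part right of \<open>B\<close> in the high-frequency bound takes
  \<open>a = 0\<close> and \<open>b = 1\<close>.\<close>

lemma norm_integral_add_tail_le:
  fixes f g :: "real \<Rightarrow> complex"
  assumes int_f: "integrable lborel f" and "integrable lborel g" and "C > 0" "\<alpha> > 0" "B > 0" "a \<ge> 0" "b \<ge> 0"
    and decay: "\<forall>y\<ge>B. cmod (f y) \<le> C / y powr (1 + \<alpha>)"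
    and bound: "\<And>u. cmod (g u) \<le> a * cmod (f u) + b * (indicator {B..} u * cmod (f u))"
  shows "cmod (LINT u|lborel. g u) \<le> a * (LINT u|lborel. cmod (f u)) + b * (C / \<alpha> * B powr (- \<alpha>))"
proof -
  have int_tail: "integrable lborel (\<lambda>u. indicator {B..} u * cmod (f u))"
    using integrable_mult_indicator[of "{B..}" lborel "\<lambda>u. cmod (f u)"] int_f by simp
  have "cmod (LINT u|lborel. g u) \<le> (LINT u|lborel. cmod (g u))"
    by (rule integral_norm_bound)
  also have "\<dots> \<le> (LINT u|lborel. a * cmod (f u) + b * (indicator {B..} u * cmod (f u)))"
    using assms int_tail by (intro integral_mono) auto
  also have "\<dots> = a * (LINT u|lborel. cmod (f u)) + b * (LINT u|lborel. indicator {B..} u * cmod (f u))"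
    using int_f int_tail by (subst Bochner_Integration.integral_add) auto
  also have "\<dots> \<le> a * (LINT u|lborel. cmod (f u)) + b * (C / \<alpha> * B powr (- \<alpha>))"
    using tail_integral_le[OF int_f \<open>C > 0\<close> \<open>\<alpha> > 0\<close> \<open>B > 0\<close> decay] \<open>b \<ge> 0\<close>
    by (intro add_left_mono mult_left_mono)
  finally show ?thesis .
qed

lemma integrable_mult_exp_i:
  fixes f :: "real \<Rightarrow> complex" and h :: "real \<Rightarrow> real"
  assumes "integrable lborel f" and [measurable]: "h \<in> borel_measurable borel"
  shows "integrable lborel (\<lambda>u. f u * exp (\<i> * complex_of_real (h u)))"
  using assms(1) by (rule Bochner_Integration.integrable_bound)
    (use assms(1)[THEN borel_measurable_integrable] in \<open>measurable, simp add: norm_mult\<close>)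

text \<open>The shifted plane wave differs from the one in \<open>vanish\<close> by a constant
  phase, so its integral against \<open>f\<close> is zero and it may be subtracted for free. Left of
  \<open>B\<close> the two phases differ by at most \<open>k * exp (B + c)\<close>; right of
  \<open>B\<close> only the trivial bound 2 is used.\<close>

lemma low_frequency_bound:
  fixes f :: "real \<Rightarrow> complex"
  assumes int_f: "integrable lborel f" and "C > 0" "\<alpha> > 0" "B > 0" "k \<ge> 0"
    and decay: "\<forall>y\<ge>B. cmod (f y) \<le> C / y powr (1 + \<alpha>)"
    and vanish: "(LINT u|lborel. f u * exp (\<i> * complex_of_real (k * u))) = 0"
  shows "cmod (LINT u|lborel. f u * exp (\<i> * complex_of_real (k * xmap (u + c))))
    \<le> k * exp (B + c) * (LINT u|lborel. cmod (f u)) + 2 * (C / \<alpha> * B powr (- \<alpha>))"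
proof -
  let ?e = "\<lambda>u. exp (\<i> * complex_of_real (k * xmap (u + c)))"
  let ?p = "\<lambda>u. exp (\<i> * complex_of_real (k * (u + c)))"
  have ints: "integrable lborel (\<lambda>u. f u * ?e u)" "integrable lborel (\<lambda>u. f u * ?p u)"
    by (rule integrable_mult_exp_i[OF int_f], measurable)+
  have "(LINT u|lborel. f u * ?p u)
      = (LINT u|lborel. f u * exp (\<i> * complex_of_real (k * u)) * exp (\<i> * complex_of_real (k * c)))"
    by (simp add: algebra_simps exp_add)
  also have "\<dots> = 0"
    using vanish by simp
  finally have "(LINT u|lborel. f u * ?e u) = (LINT u|lborel. f u * ?e u - f u * ?p u)"
    using ints by simp
  also have "cmod \<dots> \<le> k * exp (B + c) * (LINT u|lborel. cmod (f u)) + 2 * (C / \<alpha> * B powr (- \<alpha>))"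
  proof (rule norm_integral_add_tail_le[OF int_f])
    fix u
    have "cmod (?e u - ?p u) \<le> k * exp (B + c) + 2 * indicator {B..} u"
    proof (cases "u \<ge> B")
      case True
      have "0 \<le> k * exp (B + c)" using \<open>k \<ge> 0\<close> by simp
      then show ?thesis
        using True norm_exp_i_diff_le_2[of "k * xmap (u + c)" "k * (u + c)"] by simp
    next
      case False
      have "cmod (?e u - ?p u) \<le> \<bar>k * xmap (u + c) - k * (u + c)\<bar>"
        by (rule norm_exp_i_diff_le)
      also have "\<dots> = k * \<bar>xmap (u + c) - (u + c)\<bar>"
        using \<open>k \<ge> 0\<close> by (metis abs_mult abs_of_nonneg right_diff_distrib)
      also have "\<dots> \<le> k * exp (u + c)"
        using \<open>k \<ge> 0\<close> abs_xmap_diff_le by (intro mult_left_mono)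
      also have "\<dots> \<le> k * exp (B + c)"
        using \<open>k \<ge> 0\<close> False by (intro mult_left_mono) auto
      finally show ?thesis using False by simp
    qed
    then have "cmod (f u) * cmod (?e u - ?p u) \<le> cmod (f u) * (k * exp (B + c) + 2 * indicator {B..} u)"
      by (rule mult_left_mono) simp
    moreover have "cmod (f u * ?e u - f u * ?p u) = cmod (f u) * cmod (?e u - ?p u)"
      by (metis norm_mult right_diff_distrib)
    ultimately show "cmod (f u * ?e u - f u * ?p u)
        \<le> k * exp (B + c) * cmod (f u) + 2 * (indicator {B..} u * cmod (f u))"
      by (simp add: distrib_left mult.commute mult.left_commute)
  qed (use assms ints in auto)
  finally show ?thesis .
qed

text \<open>The phase has no stationary point, so one integration by parts gains
  \<open>1 / k\<close>; dividing by the derivative of \<open>xmap\<close> costs the factor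
  \<open>1 + exp (u + c)\<close>, which is largest at \<open>B\<close>. The bound does not depend on
  \<open>A\<close>, which later allows \<open>A\<close> to tend to minus infinity.\<close>

lemma oscillatory_integral_bound:
  fixes f f' :: "real \<Rightarrow> complex"
  assumes deriv: "\<And>y. (f has_vector_derivative f' y) (at y)"
    and int_f: "integrable lborel f" and int_f': "integrable lborel f'" and "k > 0" "A \<le> B"
  defines "N \<equiv> LINT u|lborel. cmod (f u)" and "N' \<equiv> LINT u|lborel. cmod (f' u)"
  shows "cmod (LINT u|lborel. indicator {A..B} u *\<^sub>R (f u * exp (\<i> * complex_of_real (k * xmap (u + c)))))
    \<le> 2 * (1 + exp (B + c)) / k * (cmod (f B) + N + N')"
proof -
  let ?e = "\<lambda>u. exp (\<i> * complex_of_real (k * xmap (u + c)))"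
  let ?w = "\<lambda>u. complex_of_real (1 + exp (u + c))"
  let ?q = "1 / (\<i> * complex_of_real k)"
  \<comment> \<open>The product \<open>?w * ?q\<close> is the reciprocal of the derivative of the
    exponent. Hence \<open>H\<close> has derivative \<open>f * ?e + r\<close>, where
    \<open>r\<close> collects the terms in which \<open>f\<close> or \<open>?w\<close> is
    differentiated.\<close>
  define r where "r = (\<lambda>u. (f' u * ?w u + f u * complex_of_real (exp (u + c))) * ?e u * ?q)"
  define H where "H = (\<lambda>u. f u * ?w u * ?e u * ?q)"
  have [measurable]: "f \<in> borel_measurable borel" "f' \<in> borel_measurable borel"
    using int_f int_f' by (auto dest: borel_measurable_integrable)
  have q: "cmod ?q = 1 / k" using \<open>k > 0\<close> by (simp add: norm_divide norm_mult)
  have H_deriv: "(H has_vector_derivative (f u * ?e u + r u)) (at u)" for u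
  proof -
    have x: "((\<lambda>u. xmap (u + c)) has_real_derivative 1 / (1 + exp (u + c))) (at u)"
      using DERIV_xmap[of "u + c"] by (simp add: DERIV_shift)
    have e: "(?e has_vector_derivative (?e u * (\<i> * complex_of_real (k * (1 / (1 + exp (u + c))))))) (at u)"
      using field_vector_diff_chain_at[OF has_vector_derivative_mult_right[OF
            has_vector_derivative_of_real[OF DERIV_cmult[OF x, of k]], of "\<i>"] DERIV_exp]
      by (simp add: o_def mult.commute)
    have w: "(?w has_vector_derivative complex_of_real (exp (u + c))) (at u)"
      by (intro has_vector_derivative_of_real)
         (auto intro!: derivative_eq_intros)
    have "(H has_vector_derivative (((f' u * ?w u + f u * complex_of_real (exp (u + c))) * ?e u
         + f u * ?w u * (?e u * (\<i> * complex_of_real (k * (1 / (1 + exp (u + c))))))) * ?q)) (at u)"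
      unfolding H_def
      by (intro has_vector_derivative_mult_left has_vector_derivative_eq_rhs[OF has_vector_derivative_mult[OF has_vector_derivative_mult[OF deriv w] e]])
         (simp add: algebra_simps)
    moreover have "f u * ?w u * (?e u * (\<i> * complex_of_real (k * (1 / (1 + exp (u + c)))))) * ?q = f u * ?e u"
      using \<open>k > 0\<close> one_plus_exp_neq_0[of "u + c"] by (simp del: of_real_add)
    ultimately show ?thesis
      by (simp add: r_def algebra_simps)
  qed
  have r_bound: "cmod (r u) \<le> (1 + exp (B + c)) / k * (cmod (f' u) + cmod (f u))" if "u \<le> B" for u
  proof -
    have "cmod (f' u * ?w u + f u * complex_of_real (exp (u + c)))
        \<le> cmod (f' u) * (1 + exp (u + c)) + cmod (f u) * exp (u + c)"
      by (rule order_trans[OF norm_triangle_ineq]) (simp add: norm_mult del: of_real_add)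
    also have "\<dots> \<le> cmod (f' u) * (1 + exp (B + c)) + cmod (f u) * (1 + exp (B + c))"
      using that by (intro add_mono mult_left_mono) (auto intro: add_increasing)
    finally have "cmod (f' u * ?w u + f u * complex_of_real (exp (u + c))) * (1 / k)
        \<le> ((1 + exp (B + c)) * (cmod (f' u) + cmod (f u))) * (1 / k)"
      using \<open>k > 0\<close> by (intro mult_right_mono) (auto simp: algebra_simps)
    then show ?thesis
      unfolding r_def norm_mult q by simp
  qed
  let ?R = "\<lambda>u. indicator {A..B} u *\<^sub>R r u"
  let ?E = "\<lambda>u. indicator {A..B} u *\<^sub>R (f u * ?e u)"
  have dom: "integrable lborel (\<lambda>u. (1 + exp (B + c)) / k * (cmod (f' u) + cmod (f u)))"
    using int_f int_f' by simp
  have int_R: "integrable lborel ?R"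
  proof (rule Bochner_Integration.integrable_bound[OF dom])
    show "?R \<in> borel_measurable lborel"
      unfolding r_def by measurable
    show "AE u in lborel. cmod (?R u) \<le> norm ((1 + exp (B + c)) / k * (cmod (f' u) + cmod (f u)))"
      using r_bound \<open>k > 0\<close>
      by (auto intro!: AE_I2 order_trans[OF _ abs_ge_self] add_nonneg_nonneg split: split_indicator)
  qed
  have int_E: "integrable lborel ?E"
    by (intro integrable_mult_indicator integrable_mult_exp_i[OF int_f]) auto
  have "((\<lambda>u. f u * ?e u + r u) has_integral H B - H A) {A..B}"
    using \<open>A \<le> B\<close> H_deriv by (intro fundamental_theorem_of_calculus) (auto intro: has_vector_derivative_at_within)
  moreover have "set_integrable lborel {A..B} (\<lambda>u. f u * ?e u + r u)"
    using Bochner_Integration.integrable_add[OF int_E int_R] by (simp add: set_integrable_def scaleR_add_right)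
  ultimately have "set_lebesgue_integral lborel {A..B} (\<lambda>u. f u * ?e u + r u) = H B - H A"
    by (metis set_borel_integral_eq_integral(2) integral_unique)
  then have "(LINT u|lborel. ?E u + ?R u) = H B - H A"
    by (simp add: set_lebesgue_integral_def scaleR_add_right)
  then have E: "(LINT u|lborel. ?E u) = H B - H A - (LINT u|lborel. ?R u)"
    using int_E int_R by (simp add: algebra_simps)
  have R: "cmod (LINT u|lborel. ?R u) \<le> (1 + exp (B + c)) / k * (N' + N)"
  proof -
    have "cmod (LINT u|lborel. ?R u) \<le> (LINT u|lborel. (1 + exp (B + c)) / k * (cmod (f' u) + cmod (f u)))"
      using int_R dom r_bound \<open>k > 0\<close>
      by (intro Bochner_Integration.integral_norm_bound_integral) (auto intro: add_nonneg_nonneg split: split_indicator)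
    also have "\<dots> = (1 + exp (B + c)) / k * (N' + N)"
      using int_f int_f' by (simp add: N_def N'_def)
    finally show ?thesis .
  qed
  have H: "cmod (H u) = (1 + exp (u + c)) / k * cmod (f u)" for u
    unfolding H_def norm_mult q by (simp add: abs_of_pos add_pos_pos del: of_real_add)
  \<comment> \<open>No pointwise decay of \<open>f\<close> on the left is assumed; the boundary
    value at \<open>A\<close> is reached from the one at \<open>B\<close> by integrating
    \<open>f'\<close>.\<close>
  have fA: "cmod (f A) \<le> cmod (f B) + N'"
  proof -
    have int: "integrable lborel (\<lambda>u. indicator {A..B} u *\<^sub>R f' u)"
      using int_f' by (intro integrable_mult_indicator) auto
    have "(f' has_integral f B - f A) {A..B}"
      using \<open>A \<le> B\<close> deriv by (intro fundamental_theorem_of_calculus) (auto intro: has_vector_derivative_at_within)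
    then have "f B - f A = (LINT u|lborel. indicator {A..B} u *\<^sub>R f' u)"
      using set_borel_integral_eq_integral(2)[of "{A..B}" f'] int
      by (simp add: set_lebesgue_integral_def set_integrable_def integral_unique)
    also have "cmod \<dots> \<le> N'"
      unfolding N'_def using int int_f'
      by (intro Bochner_Integration.integral_norm_bound_integral) (auto split: split_indicator)
    finally show ?thesis
      by (smt (verit) norm_triangle_ineq2 norm_minus_commute)
  qed
  have HA: "cmod (H A) \<le> (1 + exp (B + c)) / k * (cmod (f B) + N')"
    unfolding H using \<open>k > 0\<close> \<open>A \<le> B\<close> fA
    by (intro mult_mono divide_right_mono) (auto intro: add_nonneg_nonneg)
  have "cmod (LINT u|lborel. ?E u) \<le> cmod (H B) + cmod (H A) + cmod (LINT u|lborel. ?R u)"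
    unfolding E by (meson norm_triangle_ineq4 order_trans add_right_mono)
  also have "\<dots> \<le> (1 + exp (B + c)) / k * cmod (f B) + (1 + exp (B + c)) / k * (cmod (f B) + N')
      + (1 + exp (B + c)) / k * (N' + N)"
    using R HA H[of B] by linarith
  also have "\<dots> = (1 + exp (B + c)) / k * (2 * cmod (f B) + 2 * N' + N)"
    by (simp only: distrib_left mult_2 mult_2_right add_ac)
  also have "\<dots> \<le> (1 + exp (B + c)) / k * (2 * (cmod (f B) + N + N'))"
    (is "_ \<le> ?bound") using \<open>k > 0\<close> by (intro mult_left_mono) (auto simp: N_def intro: add_nonneg_nonneg)
  also have "?bound = 2 * (1 + exp (B + c)) / k * (cmod (f B) + N + N')"
    by (simp only: times_divide_eq_left times_divide_eq_right mult_ac)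
  finally show ?thesis .
qed

text \<open>Left of \<open>B\<close> the oscillatory bound on compact intervals is uniform in the
  left endpoint and survives the limit; right of \<open>B\<close> the decay of \<open>f\<close> is
  used without any cancellation.\<close>

lemma high_frequency_bound:
  fixes f f' :: "real \<Rightarrow> complex"
  assumes deriv: "\<And>y. (f has_vector_derivative f' y) (at y)"
    and int_f: "integrable lborel f" and int_f': "integrable lborel f'"
    and "k > 0" "C > 0" "\<alpha> > 0" "B > 0"
    and decay: "\<forall>y\<ge>B. cmod (f y) \<le> C / y powr (1 + \<alpha>)"
  shows "cmod (LINT u|lborel. f u * exp (\<i> * complex_of_real (k * xmap (u + c))))
    \<le> 2 * (1 + exp (B + c)) / k * (cmod (f B) + (LINT u|lborel. cmod (f u)) + (LINT u|lborel. cmod (f' u)))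
      + C / \<alpha> * B powr (- \<alpha>)"
proof -
  let ?g = "\<lambda>u. f u * exp (\<i> * complex_of_real (k * xmap (u + c)))"
  have int_g: "integrable lborel ?g"
    by (rule integrable_mult_exp_i[OF int_f], measurable)
  note ints = integrable_mult_indicator[OF _ int_g]
  \<comment> \<open>The left endpoint is sent to minus infinity along \<open>- real n\<close>, with
    \<open>cmod (f u)\<close> as dominating function.\<close>
  have lim: "(\<lambda>n. LINT u|lborel. indicator {- real n..B} u *\<^sub>R ?g u) \<longlonglongrightarrow> (LINT u|lborel. indicator {..B} u *\<^sub>R ?g u)"
  proof (rule integral_dominated_convergence[where w = "\<lambda>u. cmod (f u)"])
    show "AE u in lborel. (\<lambda>n. indicator {- real n..B} u *\<^sub>R ?g u) \<longlonglongrightarrow> indicator {..B} u *\<^sub>R ?g u"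
    proof (rule AE_I2, rule tendsto_eventually)
      fix u
      have "\<forall>\<^sub>F n in sequentially. - u \<le> real n"
        using real_arch_simple[of "- u"] by (meson eventually_sequentiallyI le_trans of_nat_mono order_trans)
      then show "\<forall>\<^sub>F n in sequentially. indicator {- real n..B} u *\<^sub>R ?g u = indicator {..B} u *\<^sub>R ?g u"
        by eventually_elim (auto split: split_indicator)
    qed
    show "AE u in lborel. norm (indicator {- real n..B} u *\<^sub>R ?g u) \<le> cmod (f u)" for n
      by (auto simp: norm_mult split: split_indicator)
  qed (use ints[THEN borel_measurable_integrable] int_f in auto)
  have left: "cmod (LINT u|lborel. indicator {..B} u *\<^sub>R ?g u)
      \<le> 2 * (1 + exp (B + c)) / k * (cmod (f B) + (LINT u|lborel. cmod (f u)) + (LINT u|lborel. cmod (f' u)))"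
    using \<open>B > 0\<close>
    by (intro LIMSEQ_le_const2[OF tendsto_norm[OF lim]] exI[of _ 0] allI impI
        oscillatory_integral_bound[OF deriv int_f int_f' \<open>k > 0\<close>]) simp
  have right: "cmod (LINT u|lborel. indicator {B<..} u *\<^sub>R ?g u) \<le> 0 * (LINT u|lborel. cmod (f u)) + 1 * (C / \<alpha> * B powr (- \<alpha>))"
    using assms ints by (intro norm_integral_add_tail_le[OF int_f]) (auto simp: norm_mult split: split_indicator)
  have "(LINT u|lborel. ?g u) = (LINT u|lborel. indicator {..B} u *\<^sub>R ?g u + indicator {B<..} u *\<^sub>R ?g u)"
    by (intro Bochner_Integration.integral_cong) (auto split: split_indicator)
  also have "\<dots> = (LINT u|lborel. indicator {..B} u *\<^sub>R ?g u) + (LINT u|lborel. indicator {B<..} u *\<^sub>R ?g u)"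
    using ints by (intro Bochner_Integration.integral_add) auto
  finally show ?thesis
    using norm_triangle_le left right by (smt (verit))
qed

section \<open>Integrals of the majorants over the three frequency ranges\<close>

lemma nn_integral_log_powr_below_1:
  fixes p q s \<beta> :: real
  assumes "p \<ge> 0" "q \<ge> 0" "s > 0" "\<beta> > 1"
  shows "(\<integral>\<^sup>+k. ennreal (indicator {0<..<1} k * (p + q * (s - ln k / 2) powr (- \<beta>) / k)) \<partial>lborel)
    = ennreal (p + q * 2 / (\<beta> - 1) * s powr (1 - \<beta>))"
proof -
  \<comment> \<open>The antiderivative comes from the substitution \<open>t = s - ln k / 2\<close>,
    with \<open>dt = - dk / (2 * k)\<close>; this inner derivative absorbs the factor
    \<open>- 2\<close> in \<open>cancel\<close>.\<close>
  let ?F = "\<lambda>k. p * k + q * 2 / (\<beta> - 1) * (s - ln k / 2) powr (1 - \<beta>)"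
  have cancel: "q * 2 / (\<beta> - 1) * (1 - \<beta>) = - 2 * q"
    using \<open>\<beta> > 1\<close> by (simp add: field_simps)
  have pos: "s - ln k / 2 > 0" if "0 < k" "k < 1" for k :: real
    using that \<open>s > 0\<close> ln_less_zero[of k] by linarith
  have "(\<integral>\<^sup>+k. ennreal (indicator (einterval 0 1) k * (p + q * (s - ln k / 2) powr (- \<beta>) / k)) \<partial>lborel)
    = ennreal (?F 1 - 0)"
  proof (rule nn_integral_FTC_einterval)
    fix k :: real assume "0 < ereal k" "ereal k < 1"
    then have k: "0 < k" "k < 1" by auto
    have "DERIV (\<lambda>k. (s - ln k / 2) powr (1 - \<beta>)) k
        :> (1 - \<beta>) * (s - ln k / 2) powr (- \<beta>) * - (1 / (2 * k))"
      using k pos[OF k] by (auto intro!: derivative_eq_intros)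
    then have "DERIV ?F k :> p
        + q * 2 / (\<beta> - 1) * ((1 - \<beta>) * (s - ln k / 2) powr (- \<beta>) * - (1 / (2 * k)))"
      by (intro DERIV_add DERIV_cmult_Id DERIV_cmult)
    then show "DERIV ?F k :> p + q * (s - ln k / 2) powr (- \<beta>) / k"
      unfolding mult.assoc [symmetric] cancel using k by simp
    show "isCont (\<lambda>k. p + q * (s - ln k / 2) powr (- \<beta>) / k) k"
      using k pos[OF k] by (auto intro!: continuous_intros)
    show "0 \<le> p + q * (s - ln k / 2) powr (- \<beta>) / k"
      using k assms by simp
  next
    \<comment> \<open>As \<open>k\<close> decreases to 0 the base tends to infinity while the
      exponent \<open>1 - \<beta>\<close> is negative, so the lower endpoint contributes nothing,
      although \<open>1 / k\<close> alone is not integrable there.\<close>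
    have "filterlim (\<lambda>k::real. s + - ln k * (1 / 2)) at_top (at_right 0)"
      by (intro filterlim_tendsto_add_at_top[OF tendsto_const] filterlim_at_top_mult_tendsto_pos[OF tendsto_const]
          filterlim_uminus_at_bot[THEN iffD1] ln_at_0) simp
    then have "((\<lambda>k. (s - ln k / 2) powr (1 - \<beta>)) \<longlongrightarrow> 0) (at_right 0)"
      using \<open>\<beta> > 1\<close> by (intro tendsto_neg_powr) (simp_all add: algebra_simps)
    then have "((\<lambda>k. p * k + q * 2 / (\<beta> - 1) * (s - ln k / 2) powr (1 - \<beta>)) \<longlongrightarrow> p * 0 + q * 2 / (\<beta> - 1) * 0) (at_right 0)"
      by (intro tendsto_intros)
    then show "((?F \<circ> real_of_ereal) \<longlongrightarrow> 0) (at_right 0)"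
      by (simp add: zero_ereal_def ereal_tendsto_simps del: ereal_eq_0)
  next
    have "(?F \<longlongrightarrow> ?F 1) (at_left 1)"
      using \<open>s > 0\<close> by (intro tendsto_intros) auto
    then show "((?F \<circ> real_of_ereal) \<longlongrightarrow> ?F 1) (at_left 1)"
      by (simp add: one_ereal_def ereal_tendsto_simps del: ereal_eq_1)
  qed simp
  moreover have "einterval 0 1 = {0<..<1}"
    by (auto simp: einterval_def)
  ultimately show ?thesis by simp
qed

lemma nn_integral_linear_plus_inverse:
  fixes p q K :: real
  assumes "p \<ge> 0" "q \<ge> 0" "K \<ge> 1"
  shows "(\<integral>\<^sup>+k. ennreal (p * k + q / k) * indicator {1..K} k \<partial>lborel)
    = ennreal (p * (K\<^sup>2 - 1) / 2 + q * ln K)"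
proof -
  let ?F = "\<lambda>k. p * k\<^sup>2 / 2 + q * ln k"
  have "(\<integral>\<^sup>+k. ennreal (p * k + q / k) * indicator {1..K} k \<partial>lborel) = ennreal (?F K - ?F 1)"
    using assms by (intro nn_integral_FTC_Icc) (auto intro!: derivative_eq_intros)
  then show ?thesis by (simp add: algebra_simps diff_divide_distrib)
qed

text \<open>The substitution \<open>t = s + ln (k / K) / 2\<close> turns the second term into
  \<open>2 * q * t powr (- \<beta>)\<close> integrated over \<open>t \<ge> s\<close>; dividing
  \<open>k\<close> by \<open>K\<close> makes the range start exactly at \<open>s\<close>.\<close>

lemma nn_integral_log_powr_above:
  fixes p q s \<beta> K :: real
  assumes "p \<ge> 0" "q \<ge> 0" "s > 0" "\<beta> > 1" "K > 0"
  shows "(\<integral>\<^sup>+k. ennreal (p / k\<^sup>2 + q * (s + ln (k / K) / 2) powr (- \<beta>) / k) * indicator {K..} k \<partial>lborel)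
    = ennreal (p / K + q * 2 / (\<beta> - 1) * s powr (1 - \<beta>))"
proof -
  let ?F = "\<lambda>k. - p / k - q * 2 / (\<beta> - 1) * (s + ln (k / K) / 2) powr (1 - \<beta>)"
  have cancel: "q * 2 / (\<beta> - 1) * (1 - \<beta>) = - 2 * q"
    using \<open>\<beta> > 1\<close> by (simp add: field_simps)
  have "(\<integral>\<^sup>+k. ennreal (p / k\<^sup>2 + q * (s + ln (k / K) / 2) powr (- \<beta>) / k) * indicator {K..} k \<partial>lborel)
    = ennreal (0 - ?F K)"
  proof (rule nn_integral_FTC_atLeast[where F = ?F])
    fix k assume "K \<le> k"
    then have "ln (k / K) \<ge> 0" "k > 0" using \<open>K > 0\<close> by auto
    then have pos: "s + ln (k / K) / 2 > 0" using \<open>s > 0\<close> by linarith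
    have "DERIV (\<lambda>k. - p / k) k :> p / k\<^sup>2"
      using \<open>k > 0\<close> by (auto intro!: derivative_eq_intros simp: power2_eq_square)
    moreover have "DERIV (\<lambda>k. (s + ln (k / K) / 2) powr (1 - \<beta>)) k
        :> (1 - \<beta>) * (s + ln (k / K) / 2) powr (- \<beta>) * (1 / (2 * k))"
      using pos \<open>k > 0\<close> \<open>K > 0\<close> by (auto intro!: derivative_eq_intros)
    ultimately have "DERIV ?F k :> p / k\<^sup>2
        - q * 2 / (\<beta> - 1) * ((1 - \<beta>) * (s + ln (k / K) / 2) powr (- \<beta>) * (1 / (2 * k)))"
      by (intro DERIV_diff DERIV_cmult)
    then show "DERIV ?F k :> p / k\<^sup>2 + q * (s + ln (k / K) / 2) powr (- \<beta>) / k"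
      unfolding mult.assoc [symmetric] cancel using \<open>k > 0\<close> by simp
    show "0 \<le> p / k\<^sup>2 + q * (s + ln (k / K) / 2) powr (- \<beta>) / k"
      using \<open>k > 0\<close> assms by simp
  next
    have lin: "filterlim (\<lambda>k. k * (1 / K)) at_top at_top"
      using \<open>K > 0\<close> by (intro filterlim_at_top_mult_tendsto_pos[OF tendsto_const] filterlim_ident) simp
    have "filterlim (\<lambda>k. s + ln (k * (1 / K)) * (1 / 2)) at_top at_top"
      by (intro filterlim_tendsto_add_at_top[OF tendsto_const] filterlim_at_top_mult_tendsto_pos[OF tendsto_const]
          filterlim_compose[OF ln_at_top lin]) simp
    then have "((\<lambda>k. (s + ln (k / K) / 2) powr (1 - \<beta>)) \<longlongrightarrow> 0) at_top"
      using \<open>\<beta> > 1\<close> by (intro tendsto_neg_powr) simp_all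
    moreover have "((\<lambda>k. - p / k) \<longlongrightarrow> 0) at_top"
      by (intro tendsto_divide_0[OF tendsto_const] filterlim_at_top_imp_at_infinity filterlim_ident)
    ultimately have "(?F \<longlongrightarrow> 0 - q * 2 / (\<beta> - 1) * 0) at_top"
      by (intro tendsto_intros)
    then show "(?F \<longlongrightarrow> 0) at_top" by simp
  qed simp
  then show ?thesis using \<open>K > 0\<close> by (simp add: add.commute)
qed

section \<open>From the amplitude to the integrand of the particle number\<close>

lemma fcheck_tilde_shift:
  "fcheck_tilde (\<lambda>y. f (y - c)) k
    = complex_of_real (1 / sqrt (2 * pi)) * (LINT u|lborel. f u * exp (\<i> * complex_of_real (k * xmap (u + c))))"
  unfolding fcheck_tilde_def
  by (subst lborel_integral_real_affine[where c = 1 and t = c]) (simp_all add: add.commute)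

text \<open>The inequality \<open>(P + Q)^2 \<le> 2 * (P^2 + Q^2)\<close> separates the main term
  from the tail, and its factor 2 cancels the 2 in \<open>2 * k\<close>; the remaining
  \<open>2 * pi\<close> is the Fourier normalisation.\<close>

lemma norm_fcheck_tilde_shift_sq_le:
  assumes "cmod (LINT u|lborel. f u * exp (\<i> * complex_of_real (k * xmap (u + c)))) \<le> P + Q" "k > 0"
  shows "(cmod (fcheck_tilde (\<lambda>y. f (y - c)) k))\<^sup>2 / (2 * k) \<le> (P\<^sup>2 + Q\<^sup>2) / k / (2 * pi)"
proof -
  let ?X = "cmod (LINT u|lborel. f u * exp (\<i> * complex_of_real (k * xmap (u + c))))"
  have "(cmod (fcheck_tilde (\<lambda>y. f (y - c)) k))\<^sup>2 = ?X\<^sup>2 / (2 * pi)"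
    unfolding fcheck_tilde_shift by (simp add: norm_mult norm_divide power_mult_distrib power_divide)
  moreover have "?X\<^sup>2 \<le> 2 * (P\<^sup>2 + Q\<^sup>2)"
  proof -
    have "?X\<^sup>2 \<le> (P + Q)\<^sup>2" using assms(1) by (intro power_mono) auto
    then show ?thesis using sum_squares_bound[of P Q] by (simp add: power2_sum)
  qed
  then have "?X\<^sup>2 / (4 * pi * k) \<le> 2 * (P\<^sup>2 + Q\<^sup>2) / (4 * pi * k)"
    using \<open>k > 0\<close> by (intro divide_right_mono) auto
  moreover have "2 * (P\<^sup>2 + Q\<^sup>2) / (4 * pi * k) = (P\<^sup>2 + Q\<^sup>2) / k / (2 * pi)"
    using \<open>k > 0\<close> by (simp add: field_simps)
  ultimately show ?thesis by (simp add: mult.commute mult.left_commute)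
qed

section \<open>Choice of the split points, majorants, and collection of constants\<close>

theorem theorem5:
  fixes f f' :: "real \<Rightarrow> complex" and C L \<alpha> y\<^sub>o :: real
  assumes pos_freq: "\<forall>p<0. fourier f p = 0"
    and normalised: "(\<integral>\<^sup>+ p. indicator {0<..} p * ennreal ((cmod (fourier f p))\<^sup>2 / (2 * p)) \<partial>lborel) = 1"
    and deriv: "\<forall>y. (f has_vector_derivative f' y) (at y)"
    and int_f: "integrable lborel f"
    and int_f': "integrable lborel f'"
    and C_pos: "C > 0" and L_ge: "L \<ge> 1" and alpha_gt: "\<alpha> > 1/2"
    and decay: "\<forall>y\<ge>L. cmod (f y) \<le> C / y powr (1 + \<alpha>)"
    and yo_le: "y\<^sub>o \<le> -4 * (1 + L)"
  shows "Nbar (\<lambda>y. f (y - y\<^sub>o)) \<le> ennreal (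
     1 / (\<alpha> * (2 * \<alpha> - 1)) * (8 * C\<^sup>2 / (- y\<^sub>o / 4 + L / 2 - 1) powr (2 * \<alpha> - 1))
     + 20 * exp (4 * L + y\<^sub>o / 2) *
       (2 powr (1 + \<alpha>) * C + (LINT y|lborel. cmod (f y)) + (LINT y|lborel. cmod (f' y)))\<^sup>2)"
proof -
  define N where "N = (LINT y|lborel. cmod (f y))"
  define N' where "N' = (LINT y|lborel. cmod (f' y))"
  define M where "M = 2 powr (1 + \<alpha>) * C + N + N'"
  define s where "s = - y\<^sub>o / 2"
  \<comment> \<open>This threshold balances the two methods: the comparison integrated up to
    \<open>K\<close> gives about \<open>exp (- 2 * s) * K^2\<close>, the integration by parts beyond
    \<open>K\<close> gives about \<open>1 / K^2\<close>, and both equal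
    \<open>exp (- s)\<close>.\<close>
  define K where "K = exp (- y\<^sub>o / 4)"
  define Q where "Q = C / \<alpha>"
  define D where "D = s powr (1 - 2 * \<alpha>)"
  define \<phi> where "\<phi> = (\<lambda>k. (cmod (fcheck_tilde (\<lambda>y. f (y - y\<^sub>o)) k))\<^sup>2 / (2 * k))"
  let ?I = "\<lambda>k. LINT u|lborel. f u * exp (\<i> * complex_of_real (k * xmap (u + y\<^sub>o)))"
  have y\<^sub>o: "y\<^sub>o = - 2 * s" by (simp add: s_def)
  have s_ge: "s \<ge> 2 + 2 * L" using yo_le by (simp add: s_def)
  then have "s > 0" using L_ge by simp
  have "\<alpha> > 0" "2 * \<alpha> > 1" using alpha_gt by auto
  have "Q > 0" using C_pos \<open>\<alpha> > 0\<close> by (simp add: Q_def)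
  have N: "N \<ge> 0" "N' \<ge> 0" by (simp_all add: N_def N'_def)
  have K: "K \<ge> 1" "K\<^sup>2 = exp s" "ln K = s / 2"
    using \<open>s > 0\<close> by (simp_all add: K_def y\<^sub>o power2_eq_square flip: exp_add)
  have C_le_M: "C + N + N' \<le> M" "N \<le> M"
  proof -
    have "1 \<le> 2 powr (1 + \<alpha>)" using \<open>\<alpha> > 0\<close> by (intro ge_one_powr_ge_zero) auto
    then have "1 * C \<le> 2 powr (1 + \<alpha>) * C" using C_pos by (intro mult_right_mono) auto
    then show "C + N + N' \<le> M" by (simp add: M_def)
    then show "N \<le> M" using C_pos N by linarith
  qed
  have decay': "\<forall>y\<ge>B. cmod (f y) \<le> C / y powr (1 + \<alpha>)" if "B \<ge> s" for B
    using decay that s_ge L_ge by auto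
  have powr_sq: "(B powr (- \<alpha>))\<^sup>2 = B powr (- (2 * \<alpha>))" for B :: real
    by (simp add: power2_eq_square flip: powr_add)
  \<comment> \<open>Up to the normalising constant this integral is the Fourier transform of
    \<open>f\<close> at \<open>- k\<close>.\<close>
  have vanish: "(LINT u|lborel. f u * exp (\<i> * complex_of_real (k * u))) = 0" if "k > 0" for k
    using pos_freq[rule_format, of "- k"] that by (simp add: fourier_def)
  have low: "\<phi> k \<le> ((k * exp (B + y\<^sub>o) * N)\<^sup>2 + 4 * Q\<^sup>2 * B powr (- (2 * \<alpha>))) / k / (2 * pi)"
    if "k > 0" "B \<ge> s" for k B
  proof -
    have "cmod (?I k) \<le> k * exp (B + y\<^sub>o) * N + 2 * (Q * B powr (- \<alpha>))"
      unfolding N_def Q_def using that \<open>s > 0\<close> \<open>\<alpha> > 0\<close> C_pos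
      by (intro low_frequency_bound[OF int_f _ _ _ _ decay'] vanish) auto
    from norm_fcheck_tilde_shift_sq_le[OF this \<open>k > 0\<close>] show ?thesis
      by (simp add: \<phi>_def power_mult_distrib powr_sq mult.assoc)
  qed
  have high: "\<phi> k \<le> ((2 * (1 + exp (B + y\<^sub>o)) / k * M)\<^sup>2 + Q\<^sup>2 * B powr (- (2 * \<alpha>))) / k / (2 * pi)"
    if "k > 0" "B \<ge> s" for k B
  proof -
    have "B \<ge> 1" using that s_ge L_ge by linarith
    have "cmod (f B) \<le> C / B powr (1 + \<alpha>)"
      using decay' that by blast
    also have "\<dots> \<le> C / 1"
      using C_pos \<open>B \<ge> 1\<close> \<open>\<alpha> > 0\<close> by (intro divide_left_mono ge_one_powr_ge_zero) auto
    finally have "cmod (f B) + N + N' \<le> M" using C_le_M by simp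
    then have "2 * (1 + exp (B + y\<^sub>o)) / k * (cmod (f B) + N + N') \<le> 2 * (1 + exp (B + y\<^sub>o)) / k * M"
      using \<open>k > 0\<close> by (intro mult_left_mono) (auto intro: add_nonneg_nonneg)
    moreover have "cmod (?I k) \<le> 2 * (1 + exp (B + y\<^sub>o)) / k * (cmod (f B) + N + N') + Q * B powr (- \<alpha>)"
      unfolding N_def N'_def Q_def using that \<open>B \<ge> 1\<close> \<open>\<alpha> > 0\<close> C_pos deriv
      by (intro high_frequency_bound[OF _ int_f int_f' _ _ _ _ decay']) auto
    ultimately have "cmod (?I k) \<le> 2 * (1 + exp (B + y\<^sub>o)) / k * M + Q * B powr (- \<alpha>)"
      by linarith
    from norm_fcheck_tilde_shift_sq_le[OF this \<open>k > 0\<close>] show ?thesis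
      by (simp add: \<phi>_def power_mult_distrib powr_sq)
  qed

  \<comment> \<open>Each majorant is the bound at the chosen split point. With a fixed split point
    the squared tail would be a constant times \<open>dk / k\<close>, divergent at 0 and at
    infinity; letting the split point grow logarithmically in those two ranges makes it integrable
    because \<open>2 * \<alpha> > 1\<close>. The middle range is bounded, so \<open>B = s\<close>
    suffices.\<close>
  define h1 where "h1 = (\<lambda>k. exp (- 2 * s) * N\<^sup>2 / (2 * pi) + 4 * Q\<^sup>2 / (2 * pi) * (s - ln k / 2) powr (- (2 * \<alpha>)) / k)"
  define h2 where "h2 = (\<lambda>k. exp (- 2 * s) * N\<^sup>2 / (2 * pi) * k + 4 * Q\<^sup>2 * s powr (- (2 * \<alpha>)) / (2 * pi) / k)"
  define h3 where "h3 = (\<lambda>k. 16 * M\<^sup>2 / K / (2 * pi) / k\<^sup>2 + Q\<^sup>2 / (2 * pi) * (s + ln (k / K) / 2) powr (- (2 * \<alpha>)) / k)"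
  have b1: "\<phi> k \<le> h1 k" if "0 < k" "k < 1" for k
  proof -
    have "s - ln k / 2 \<ge> s" using that by simp
    note low[OF \<open>k > 0\<close> this]
    \<comment> \<open>The logarithm in the split point replaces \<open>k^2\<close> by
      \<open>k\<close>, so that division by \<open>k\<close> leaves the constant first term of
      \<open>h1\<close>.\<close>
    also have "(k * exp (s - ln k / 2 + y\<^sub>o) * N)\<^sup>2 = k * exp (- 2 * s) * N\<^sup>2"
    proof -
      have "(exp (s - ln k / 2 + y\<^sub>o))\<^sup>2 = exp (- 2 * s - ln k)"
        by (simp add: y\<^sub>o power2_eq_square flip: exp_add)
      also have "\<dots> = exp (- 2 * s) / k"
        using that by (simp add: exp_diff)
      finally have "(k * exp (s - ln k / 2 + y\<^sub>o) * N)\<^sup>2 = k\<^sup>2 * (exp (- 2 * s) / k) * N\<^sup>2"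
        unfolding power_mult_distrib by simp
      then show ?thesis
        using that by (simp add: power2_eq_square)
    qed
    finally show ?thesis
      using that by (simp add: h1_def add_divide_distrib)
  qed
  have b2: "\<phi> k \<le> h2 k" if "1 \<le> k" for k
  proof -
    have "k > 0" using that by simp
    have "(exp (s + y\<^sub>o))\<^sup>2 = exp (- 2 * s)"
      by (simp add: y\<^sub>o power2_eq_square flip: exp_add)
    with low[OF \<open>k > 0\<close> order_refl] show ?thesis
      using that by (simp add: h2_def add_divide_distrib power_mult_distrib power2_eq_square mult_ac)
  qed
  \<comment> \<open>At this split point \<open>exp (B + y\<^sub>o)\<close> is
    \<open>exp (- s) * sqrt (k / K)\<close>, and \<open>k \<ge> K\<close> lets
    \<open>sqrt (k / K)\<close> absorb the summand 1 as well. The square of the by-parts bound is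
    then at most \<open>16 * M^2 / (K * k)\<close>, still integrable against
    \<open>dk / k\<close>.\<close>
  have b3: "\<phi> k \<le> h3 k" if "K \<le> k" for k
  proof -
    have "k > 0" and r: "k / K \<ge> 1" using that K(1) by auto
    then have B: "s + ln (k / K) / 2 \<ge> s" by simp
    have sqrt_eq: "exp (ln (k / K) / 2) = sqrt (k / K)"
      using r by (simp add: ln_sqrt[symmetric])
    have "exp (s + ln (k / K) / 2 + y\<^sub>o) = exp (- s) * sqrt (k / K)"
      by (simp add: y\<^sub>o sqrt_eq flip: sqrt_eq exp_add)
    also have "\<dots> \<le> 1 * sqrt (k / K)"
      using \<open>s > 0\<close> r by (intro mult_right_mono) auto
    finally have "1 + exp (s + ln (k / K) / 2 + y\<^sub>o) \<le> 2 * sqrt (k / K)"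
      using r real_sqrt_ge_one[of "k / K"] by linarith
    then have "(1 + exp (s + ln (k / K) / 2 + y\<^sub>o))\<^sup>2 \<le> (2 * sqrt (k / K))\<^sup>2"
      by (intro power_mono) (auto intro: add_nonneg_nonneg)
    also have "\<dots> = 4 * (k / K)"
      using r by (simp add: power_mult_distrib)
    finally have "4 * M\<^sup>2 / k\<^sup>2 * (1 + exp (s + ln (k / K) / 2 + y\<^sub>o))\<^sup>2 \<le> 4 * M\<^sup>2 / k\<^sup>2 * (4 * (k / K))"
      by (intro mult_left_mono) auto
    also have "\<dots> = 16 * M\<^sup>2 / K / k\<^sup>2 * k"
      by (simp add: mult.commute)
    finally have P: "(2 * (1 + exp (s + ln (k / K) / 2 + y\<^sub>o)) / k * M)\<^sup>2 \<le> 16 * M\<^sup>2 / K / k\<^sup>2 * k"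
      by (simp add: power_mult_distrib power_divide mult_ac del: distrib_left_numeral)
    have "\<phi> k \<le> ((2 * (1 + exp (s + ln (k / K) / 2 + y\<^sub>o)) / k * M)\<^sup>2 + Q\<^sup>2 * (s + ln (k / K) / 2) powr (- (2 * \<alpha>))) / k / (2 * pi)"
      by (rule high[OF \<open>k > 0\<close> B])
    also have "\<dots> \<le> (16 * M\<^sup>2 / K / k\<^sup>2 * k + Q\<^sup>2 * (s + ln (k / K) / 2) powr (- (2 * \<alpha>))) / k / (2 * pi)"
      using P \<open>k > 0\<close> by (intro divide_right_mono add_right_mono) auto
    also have "\<dots> = h3 k"
      using \<open>k > 0\<close> by (simp add: h3_def add_divide_distrib mult_ac)
    finally show ?thesis .
  qed

  let ?T1 = "exp (- 2 * s) * N\<^sup>2 / (2 * pi) + 4 * Q\<^sup>2 / (2 * pi) * 2 / (2 * \<alpha> - 1) * D"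
  let ?T2 = "exp (- 2 * s) * N\<^sup>2 / (2 * pi) * (K\<^sup>2 - 1) / 2 + 4 * Q\<^sup>2 * s powr (- (2 * \<alpha>)) / (2 * pi) * ln K"
  let ?T3 = "16 * M\<^sup>2 / K / (2 * pi) / K + Q\<^sup>2 / (2 * pi) * 2 / (2 * \<alpha> - 1) * D"
  have [measurable]: "h1 \<in> borel_measurable borel" "h2 \<in> borel_measurable borel" "h3 \<in> borel_measurable borel"
    unfolding h1_def h2_def h3_def by measurable
  have I1: "(\<integral>\<^sup>+k. ennreal (indicator {0<..<1} k * h1 k) \<partial>lborel) = ennreal ?T1"
    unfolding h1_def D_def using \<open>s > 0\<close> \<open>2 * \<alpha> > 1\<close> by (intro nn_integral_log_powr_below_1) auto
  have I2: "(\<integral>\<^sup>+k. ennreal (h2 k) * indicator {1..K} k \<partial>lborel) = ennreal ?T2"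
    unfolding h2_def using K(1) by (intro nn_integral_linear_plus_inverse) auto
  have I3: "(\<integral>\<^sup>+k. ennreal (h3 k) * indicator {K..} k \<partial>lborel) = ennreal ?T3"
    unfolding h3_def D_def using \<open>s > 0\<close> \<open>2 * \<alpha> > 1\<close> K(1) by (intro nn_integral_log_powr_above) auto
  have "Nbar (\<lambda>y. f (y - y\<^sub>o)) = (\<integral>\<^sup>+k. indicator {0<..} k * ennreal (\<phi> k) \<partial>lborel)"
    by (simp add: Nbar_def \<phi>_def)
  also have "\<dots> \<le> (\<integral>\<^sup>+k. ennreal (indicator {0<..<1} k * h1 k) + (ennreal (h2 k) * indicator {1..K} k + ennreal (h3 k) * indicator {K..} k) \<partial>lborel)"
  proof (rule nn_integral_mono)
    fix k :: real
    let ?g1 = "ennreal (indicator {0<..<1} k * h1 k)"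
      and ?g2 = "ennreal (h2 k) * indicator {1..K} k" and ?g3 = "ennreal (h3 k) * indicator {K..} k"
    consider "k \<le> 0" | "0 < k" "k < 1" | "1 \<le> k" "k \<le> K" | "0 < k" "K \<le> k"
      using K(1) by linarith
    then show "indicator {0<..} k * ennreal (\<phi> k) \<le> ?g1 + (?g2 + ?g3)"
    proof cases
      case 2
      then have "indicator {0<..} k * ennreal (\<phi> k) \<le> ?g1"
        using b1[OF 2] by (simp add: ennreal_leI)
      then show ?thesis by (rule add_increasing2[OF zero_le])
    next
      case 3
      then have "indicator {0<..} k * ennreal (\<phi> k) \<le> ?g2"
        using b2[OF 3(1)] by (simp add: ennreal_leI)
      then show ?thesis by (intro add_increasing[OF zero_le] add_increasing2[OF zero_le])
    next
      case 4
      then have "indicator {0<..} k * ennreal (\<phi> k) \<le> ?g3"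
        using b3[OF 4(2)] by (simp add: ennreal_leI)
      then show ?thesis by (intro add_increasing[OF zero_le])
    qed simp
  qed
  also have "\<dots> = ennreal ?T1 + (ennreal ?T2 + ennreal ?T3)"
    by (simp add: nn_integral_add I1 I2 I3)
  also have "\<dots> = ennreal (?T1 + (?T2 + ?T3))"
  proof -
    have "0 \<le> ?T1" "0 \<le> ?T2" "0 \<le> ?T3"
      using \<open>2 * \<alpha> > 1\<close> K(1) by (simp_all add: D_def)
    then show ?thesis by (simp only: ennreal_plus add_nonneg_nonneg)
  qed
  also have "\<dots> \<le> ennreal (1 / (\<alpha> * (2 * \<alpha> - 1)) * (8 * C\<^sup>2 / (- y\<^sub>o / 4 + L / 2 - 1) powr (2 * \<alpha> - 1))
     + 20 * exp (4 * L + y\<^sub>o / 2) * M\<^sup>2)"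
  proof (rule ennreal_leI)
    define E where "E = exp (- s)"
    have "E > 0" "E \<le> 1" using \<open>s > 0\<close> by (auto simp: E_def)
    have E2: "exp (- 2 * s) = E\<^sup>2" and K2: "1 / K / K = E" and EK: "E\<^sup>2 * K\<^sup>2 = E"
      using K(2) by (simp_all add: E_def power2_eq_square exp_minus field_simps flip: exp_add)
    \<comment> \<open>The factor \<open>s\<close> comes from \<open>ln K = s / 2\<close>, the
      logarithmic length of the middle range; it brings the tail there to the same order
      \<open>D\<close> as in the outer ranges.\<close>
    have sD: "s powr (- (2 * \<alpha>)) * s = D"
      using \<open>s > 0\<close> powr_mult_base[of s "- (2 * \<alpha>)"] by (simp add: D_def mult.commute)
    define a where "a = 2 * \<alpha> - 1"
    have a: "a > 0" using \<open>2 * \<alpha> > 1\<close> by (simp add: a_def)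
    \<comment> \<open>The terms are sorted into those of order \<open>exp (- s)\<close> and the
      tails of order \<open>D\<close>. The tails of the three ranges have weights
      \<open>8 / a\<close>, 2 and \<open>2 / a\<close>.\<close>
    have "?T1 + (?T2 + ?T3) = (E\<^sup>2 * N\<^sup>2 + (E\<^sup>2 * K\<^sup>2 - E\<^sup>2) * N\<^sup>2 / 2 + 16 * M\<^sup>2 * (1 / K / K)) / (2 * pi)
        + (8 / (2 * \<alpha> - 1) * D + 2 * (s powr (- (2 * \<alpha>)) * s) + 2 / (2 * \<alpha> - 1) * D) * Q\<^sup>2 / (2 * pi)"
      unfolding E2 K(3) a_def [symmetric] using a by (simp add: field_simps)
    also have "\<dots> = (E\<^sup>2 * N\<^sup>2 / 2 + E * N\<^sup>2 / 2 + 16 * M\<^sup>2 * E) / (2 * pi)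
        + (10 / (2 * \<alpha> - 1) + 2) * D * Q\<^sup>2 / (2 * pi)"
      unfolding EK K2 sD a_def [symmetric] using a by (simp add: field_simps)
    also have "\<dots> \<le> 20 * exp (4 * L + y\<^sub>o / 2) * M\<^sup>2
        + 1 / (\<alpha> * (2 * \<alpha> - 1)) * (8 * C\<^sup>2 / (- y\<^sub>o / 4 + L / 2 - 1) powr (2 * \<alpha> - 1))"
    proof (rule add_mono)
      \<comment> \<open>The weights 1/2, 1/2 and 16 add up to 17, below 20. The gain from
        \<open>1 / (2 * pi)\<close> is given away, and
        \<open>exp (- s) = exp (y\<^sub>o / 2)\<close> is enlarged by
        \<open>exp (4 * L)\<close>.\<close>
      have "N\<^sup>2 \<le> M\<^sup>2" using C_le_M N by (intro power_mono)
      have "E\<^sup>2 * N\<^sup>2 \<le> E * M\<^sup>2"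
        using \<open>E > 0\<close> \<open>E \<le> 1\<close> \<open>N\<^sup>2 \<le> M\<^sup>2\<close> by (intro mult_mono) (auto simp: power2_eq_square mult_le_one)
      moreover have "E * N\<^sup>2 \<le> E * M\<^sup>2"
        using \<open>E > 0\<close> \<open>N\<^sup>2 \<le> M\<^sup>2\<close> by (intro mult_left_mono) auto
      moreover have "0 \<le> E * M\<^sup>2" "16 * M\<^sup>2 * E = 16 * (E * M\<^sup>2)"
        using \<open>E > 0\<close> by auto
      ultimately have "E\<^sup>2 * N\<^sup>2 / 2 + E * N\<^sup>2 / 2 + 16 * M\<^sup>2 * E \<le> 20 * (E * M\<^sup>2)"
        by linarith
      then have "(E\<^sup>2 * N\<^sup>2 / 2 + E * N\<^sup>2 / 2 + 16 * M\<^sup>2 * E) / (2 * pi) \<le> 20 * (E * M\<^sup>2) / (2 * pi)"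
        by (intro divide_right_mono) auto
      also have "\<dots> \<le> 20 * (E * M\<^sup>2) / 1"
        using \<open>E > 0\<close> pi_gt3 by (intro divide_left_mono) auto
      also have "\<dots> \<le> 20 * (exp (4 * L + y\<^sub>o / 2) * M\<^sup>2) / 1"
        using L_ge by (intro divide_right_mono mult_left_mono mult_right_mono) (auto simp: E_def y\<^sub>o)
      finally show "(E\<^sup>2 * N\<^sup>2 / 2 + E * N\<^sup>2 / 2 + 16 * M\<^sup>2 * E) / (2 * pi) \<le> 20 * exp (4 * L + y\<^sub>o / 2) * M\<^sup>2"
        by simp
    next
      \<comment> \<open>Here \<open>?Y\<close> equals \<open>s / 2 + L / 2 - 1\<close>, which lies
        between 0 and \<open>s\<close>; since \<open>D\<close> is a negative power, replacing
        \<open>s\<close> by \<open>?Y\<close> only enlarges it.\<close>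
      let ?Y = "- y\<^sub>o / 4 + L / 2 - 1"
      have Y: "0 < ?Y" "?Y \<le> s" using s_ge L_ge by (auto simp: y\<^sub>o)
      have D: "0 \<le> D" "D \<le> 1 / ?Y powr (2 * \<alpha> - 1)"
      proof -
        have "D = 1 / s powr (2 * \<alpha> - 1)"
          using powr_minus_divide[of s "2 * \<alpha> - 1"] by (simp add: D_def)
        also have "\<dots> \<le> 1 / ?Y powr (2 * \<alpha> - 1)"
          using Y \<open>2 * \<alpha> > 1\<close> by (intro divide_left_mono powr_mono2) auto
        finally show "D \<le> 1 / ?Y powr (2 * \<alpha> - 1)" .
      qed (simp add: D_def)
      have "(10 / (2 * \<alpha> - 1) + 2) * Q\<^sup>2 / (2 * pi) \<le> (10 / (2 * \<alpha> - 1) + 2) * Q\<^sup>2 / 6"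
        using pi_gt3 \<open>2 * \<alpha> > 1\<close> by (intro divide_left_mono) auto
      also have "\<dots> = (8 / \<alpha> + 4) / 6 * (C\<^sup>2 / (\<alpha> * (2 * \<alpha> - 1)))"
        using \<open>2 * \<alpha> > 1\<close> \<open>\<alpha> > 0\<close> by (simp add: Q_def divide_simps power2_eq_square)
      \<comment> \<open>From \<open>\<alpha> > 1/2\<close> it follows that
        \<open>8 / \<alpha> < 16\<close>, so the prefactor is below \<open>20 / 6\<close>, well
        under 8.\<close>
      also have "\<dots> \<le> 8 * (C\<^sup>2 / (\<alpha> * (2 * \<alpha> - 1)))"
        using \<open>2 * \<alpha> > 1\<close> \<open>\<alpha> > 0\<close> by (intro mult_right_mono) (auto simp: field_simps)
      finally have "(10 / (2 * \<alpha> - 1) + 2) * Q\<^sup>2 / (2 * pi) * D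
          \<le> 8 * (C\<^sup>2 / (\<alpha> * (2 * \<alpha> - 1))) * (1 / ?Y powr (2 * \<alpha> - 1))"
        using D \<open>2 * \<alpha> > 1\<close> \<open>\<alpha> > 0\<close> by (intro mult_mono) auto
      then show "(10 / (2 * \<alpha> - 1) + 2) * D * Q\<^sup>2 / (2 * pi)
          \<le> 1 / (\<alpha> * (2 * \<alpha> - 1)) * (8 * C\<^sup>2 / ?Y powr (2 * \<alpha> - 1))"
        by (simp add: mult_ac)
    qed
    finally show "?T1 + (?T2 + ?T3) \<le> 1 / (\<alpha> * (2 * \<alpha> - 1)) * (8 * C\<^sup>2 / (- y\<^sub>o / 4 + L / 2 - 1) powr (2 * \<alpha> - 1))
        + 20 * exp (4 * L + y\<^sub>o / 2) * M\<^sup>2"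
      by (simp only: add.commute)
  qed
  finally show ?thesis
    by (simp only: M_def N_def N'_def)
qed

end
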